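(* Let $X,Y$ be real reflexive Banach spaces and let $Z$ be a real normed linear space, all of dimension strictly greater than one. If $\mathcal{T}\in\mathscr{K}(X\times Y,Z)$ is weak-weak continuous, then $\mathcal{T}$ attains its norm, i.e., there exists $(x_0,y_0)\in S_X\times S_Y$ with $\|\mathcal{T}(x_0,y_0)\|=\|\mathcal{T}\|$.
   Context: $S_X$ denotes the unit sphere of $X$. $X\times Y$ carries the norm $\|(x,y)\|_\infty=\max\{\|x\|,\|y\|\}$. For a bilinear operator $\mathcal{T}:X\times Y\to Z$, $\|\mathcal{T}\|=\sup\{\|\mathcal{T}(x,y)\|:(x,y)\in S_X\times S_Y\}$. $\mathcal{T}$ is compact if for every bounded sequence $\{(x_n,y_n)\}\subset X\times Y$, the sequence $\{\mathcal{T}(x_n,y_n)\}$ has a convergent subsequence; $\mathscr{K}(X\times Y,Z)$ is the space of compact bilinear operators from $X\times Y$ to $Z$. Weak-weak continuous means continuous from $X\times Y$ with its weak topology to $Z$ with its weak topology. *)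

theory Defs
  imports "HOL-Analysis.Analysis"
begin

text \<open>Dimension greater than one, by the cardinality of a Hamel basis. The library's
  \<^const>\<open>dim\<close> is not used because it is 0 on infinite-dimensional spaces.\<close>

definition dim_gt_one :: "'a::real_vector itself \<Rightarrow> bool" where
  "dim_gt_one _ \<longleftrightarrow>
     (\<exists>B::'a set. independent B \<and> span B = UNIV \<and> (infinite B \<or> card B > 1))"

text \<open>The canonical embedding into the bidual is onto.\<close>

definition reflexive_space :: "'a::real_normed_vector itself \<Rightarrow> bool" where
  "reflexive_space _ \<longleftrightarrow>
     (\<forall>\<phi> :: ('a \<Rightarrow>\<^sub>L real) \<Rightarrow>\<^sub>L real.
        \<exists>x::'a. \<forall>f. blinfun_apply \<phi> f = blinfun_apply f x)"

text \<open>The norm is a parameter since the library's norm on a product type is the Euclidean one,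
  while here products carry the maximum norm.\<close>

definition max_norm :: "'a::real_normed_vector \<times> 'b::real_normed_vector \<Rightarrow> real" where
  "max_norm p = max (norm (fst p)) (norm (snd p))"

definition dual_wrt :: "('v::real_vector \<Rightarrow> real) \<Rightarrow> ('v \<Rightarrow> real) set" where
  "dual_wrt N = {f. linear f \<and> (\<exists>K. \<forall>v. \<bar>f v\<bar> \<le> K * N v)}"

definition weak_topology :: "('v::real_vector \<Rightarrow> real) \<Rightarrow> 'v topology" where
  "weak_topology N = topology_generated_by {f -` U | f U. f \<in> dual_wrt N \<and> open U}"

definition weak_weak_continuous ::
  "('a::real_normed_vector \<Rightarrow> 'b::real_normed_vector \<Rightarrow> 'c::real_normed_vector) \<Rightarrow> bool" where
  "weak_weak_continuous T \<longleftrightarrow>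
     continuous_map (weak_topology max_norm) (weak_topology norm) (\<lambda>(x, y). T x y)"

text \<open>Boundedness of the operator is not required separately: it follows from compactness.\<close>

definition compact_bilinear ::
  "('a::real_normed_vector \<Rightarrow> 'b::real_normed_vector \<Rightarrow> 'c::real_normed_vector) \<Rightarrow> bool" where
  "compact_bilinear T \<longleftrightarrow> bilinear T \<and>
     (\<forall>s :: nat \<Rightarrow> 'a \<times> 'b. (\<exists>C. \<forall>n. max_norm (s n) \<le> C) \<longrightarrow>
        (\<exists>r :: nat \<Rightarrow> nat. strict_mono r \<and>
           convergent (\<lambda>n. T (fst (s (r n))) (snd (s (r n))))))"

definition bilinear_norm ::
  "('a::real_normed_vector \<Rightarrow> 'b::real_normed_vector \<Rightarrow> 'c::real_normed_vector) \<Rightarrow> real" where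
  "bilinear_norm T = (SUP (x, y) \<in> sphere 0 1 \<times> sphere 0 1. norm (T x y))"

end

theory Submission
  imports Defs
begin

text \<open>
  Take points of the two unit spheres along which \<^term>\<open>norm (T x y)\<close> tends to the norm of \<open>T\<close>.
  Compactness of \<open>T\<close> lets us pass to a subsequence on which the values \<open>T x y\<close> converge in norm, say
  to \<open>z\<close>, so that \<^term>\<open>norm z\<close> is the norm of \<open>T\<close>. The unit balls of the reflexive spaces are
  weakly compact, so along some ultrafilter on the indices the points converge weakly to a pair
  \<open>(x, y)\<close> of vectors of norm at most one. Weak-weak continuity makes the values converge weakly
  to \<open>T x y\<close>, and they also converge to \<open>z\<close>; continuous functionals separate points, whence
  \<open>T x y = z\<close> (\<open>weak_weak_continuous_attains_limit\<close>). Unless \<open>T\<close> vanishes, \<open>x\<close> and \<open>y\<close> are nonzero,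
  and normalising them can only increase the value, so the norm is attained on the spheres.

  Two tools carry this argument. The first is Hahn--Banach, in the form that every sublinear
  functional dominates a linear one (\<open>sublinear_dominates_linear\<close>); it yields a norming functional
  for each vector. The second is weak compactness: along an ultrafilter every bounded scalar family
  converges, so the evaluations of the functionals at a bounded family have limits which together
  form an element of the bidual; reflexivity turns this element into a weak limit
  (\<open>reflexive_ultra_weak_limit\<close>). Ultrafilters are used instead of subsequences because the limits for
  all functionals are needed at once, and the dual need not be separable.
\<close>

section \<open>Extension of sublinear functionals\<close>

text \<open>Positive homogeneity is stated as an inequality, which is all that must be checked for
  infima of such functionals; equality and the value at \<open>0\<close> follow.\<close>

definition sublinear :: "('v::real_vector \<Rightarrow> real) \<Rightarrow> bool" where
  "sublinear p \<longleftrightarrow>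
     (\<forall>x y. p (x + y) \<le> p x + p y) \<and> (\<forall>c>0. \<forall>x. p (c *\<^sub>R x) \<le> c * p x)"

lemma sublinear_zero:
  assumes "sublinear p"
  shows "p 0 = 0"
proof -
  have "p (0 + 0) \<le> p 0 + p 0"
    using assms unfolding sublinear_def by blast
  moreover have "p ((1/2) *\<^sub>R 0) \<le> (1/2) * p 0"
    using assms unfolding sublinear_def by (meson half_gt_zero zero_less_one)
  ultimately show ?thesis by simp
qed

lemma sublinear_minus_ge:
  assumes "sublinear p"
  shows "- p (- x) \<le> p x"
proof -
  have "p (x + - x) \<le> p x + p (- x)"
    using assms unfolding sublinear_def by blast
  then show ?thesis using sublinear_zero[OF assms] by simp
qed

lemma sublinear_scaleR:
  assumes "sublinear p" "c > 0"
  shows "p (c *\<^sub>R x) = c * p x"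
proof -
  have "p (inverse c *\<^sub>R (c *\<^sub>R x)) \<le> inverse c * p (c *\<^sub>R x)"
    using assms unfolding sublinear_def by (meson positive_imp_inverse_positive)
  then have "c * p x \<le> p (c *\<^sub>R x)"
    using assms(2) by (simp add: field_simps)
  moreover have "p (c *\<^sub>R x) \<le> c * p x"
    using assms unfolding sublinear_def by blast
  ultimately show ?thesis by simp
qed

lemma sublinear_norm: "sublinear norm"
  unfolding sublinear_def by (simp add: norm_triangle_ineq)

text \<open>This is the largest sublinear \<open>q \<le> p\<close> with \<open>q (- y) \<le> - p y\<close>, that is, one that is
  linear on the line through \<open>y\<close> and still agrees with \<open>p\<close> at \<open>y\<close>. It serves twice: for \<open>p\<close> the norm it
  prescribes the value of a functional at \<open>y\<close>, and for a minimal \<open>p\<close> it forces linearity.\<close>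

definition flatten_along :: "('v::real_vector \<Rightarrow> real) \<Rightarrow> 'v \<Rightarrow> 'v \<Rightarrow> real" where
  "flatten_along p y v = (INF t\<in>{0..}. p (v + t *\<^sub>R y) - t * p y)"

lemma flatten_along_bdd_below:
  assumes "sublinear p"
  shows "bdd_below ((\<lambda>t. p (v + t *\<^sub>R y) - t * p y) ` {0..})"
proof (rule bdd_belowI2)
  fix t :: real
  assume "t \<in> {0..}"
  then have "p (t *\<^sub>R y) = t * p y"
    using sublinear_scaleR[OF assms, of t y] sublinear_zero[OF assms] by (cases "t = 0") auto
  moreover have "p ((v + t *\<^sub>R y) + - v) \<le> p (v + t *\<^sub>R y) + p (- v)"
    using assms unfolding sublinear_def by blast
  ultimately show "- p (- v) \<le> p (v + t *\<^sub>R y) - t * p y" by simp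
qed

lemma flatten_along_le:
  assumes "sublinear p" "t \<ge> 0"
  shows "flatten_along p y v \<le> p (v + t *\<^sub>R y) - t * p y"
  unfolding flatten_along_def
  using flatten_along_bdd_below[OF assms(1)] assms(2) by (intro cINF_lower) auto

lemma flatten_along_greatest:
  assumes "\<And>t. t \<ge> 0 \<Longrightarrow> b \<le> p (v + t *\<^sub>R y) - t * p y"
  shows "b \<le> flatten_along p y v"
  unfolding flatten_along_def using assms by (intro cINF_greatest) auto

lemma flatten_along_le_self:
  assumes "sublinear p"
  shows "flatten_along p y v \<le> p v"
  using flatten_along_le[OF assms, of 0 y v] by simp

lemma flatten_along_minus:
  assumes "sublinear p"
  shows "flatten_along p y (- y) \<le> - p y"
  using flatten_along_le[OF assms, of 1 y "- y"] sublinear_zero[OF assms] by simp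

lemma sublinear_flatten_along:
  assumes p: "sublinear p"
  shows "sublinear (flatten_along p y)"
proof -
  let ?q = "flatten_along p y"
  have "?q (u + v) \<le> ?q u + ?q v" for u v
  proof -
    have "?q (u + v) \<le> (p (u + s *\<^sub>R y) - s * p y) + (p (v + t *\<^sub>R y) - t * p y)"
      if "s \<ge> 0" "t \<ge> 0" for s t
    proof -
      have "?q (u + v) \<le> p ((u + v) + (s + t) *\<^sub>R y) - (s + t) * p y"
        using that by (intro flatten_along_le[OF p]) auto
      also have "(u + v) + (s + t) *\<^sub>R y = (u + s *\<^sub>R y) + (v + t *\<^sub>R y)"
        by (simp add: algebra_simps)
      also have "p \<dots> \<le> p (u + s *\<^sub>R y) + p (v + t *\<^sub>R y)"
        using p unfolding sublinear_def by blast
      finally show ?thesis by (simp add: algebra_simps)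
    qed
    then have "?q (u + v) - (p (u + s *\<^sub>R y) - s * p y) \<le> ?q v" if "s \<ge> 0" for s
      using that by (intro flatten_along_greatest) (smt (verit))
    then have "?q (u + v) - ?q v \<le> ?q u"
      by (intro flatten_along_greatest) (simp add: algebra_simps)
    then show ?thesis by simp
  qed
  moreover have "?q (c *\<^sub>R v) \<le> c * ?q v" if c: "c > 0" for c v
  proof -
    have "?q (c *\<^sub>R v) / c \<le> p (v + t *\<^sub>R y) - t * p y" if "t \<ge> 0" for t
    proof -
      have "?q (c *\<^sub>R v) \<le> p (c *\<^sub>R v + (c * t) *\<^sub>R y) - (c * t) * p y"
        using c that by (intro flatten_along_le[OF p]) auto
      also have "c *\<^sub>R v + (c * t) *\<^sub>R y = c *\<^sub>R (v + t *\<^sub>R y)"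
        by (simp add: algebra_simps)
      also have "p \<dots> = c * p (v + t *\<^sub>R y)"
        using sublinear_scaleR[OF p c] .
      finally show ?thesis using c by (simp add: field_simps)
    qed
    then have "?q (c *\<^sub>R v) / c \<le> ?q v"
      by (rule flatten_along_greatest)
    then show ?thesis using c by (simp add: field_simps)
  qed
  ultimately show ?thesis unfolding sublinear_def by blast
qed

text \<open>The pointwise infimum works: it is finite because \<open>q v \<ge> - q (- v) \<ge> - p (- v)\<close>, and
  subadditive because any two members of a chain lie above a common one.\<close>

lemma sublinear_chain_lower_bound:
  assumes sub: "\<And>q. q \<in> C \<Longrightarrow> sublinear q \<and> q \<le> p"
    and chain: "\<And>q q'. q \<in> C \<Longrightarrow> q' \<in> C \<Longrightarrow> q \<le> q' \<or> q' \<le> q"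
    and ne: "C \<noteq> {}"
  shows "\<exists>m. sublinear m \<and> m \<le> p \<and> (\<forall>q\<in>C. m \<le> q)"
proof -
  define m where "m v = (INF q\<in>C. q v)" for v
  have bdd: "bdd_below ((\<lambda>q. q v) ` C)" for v
  proof (rule bdd_belowI2)
    fix q assume "q \<in> C"
    then have "- q (- v) \<le> q v" "q (- v) \<le> p (- v)"
      using sub sublinear_minus_ge by (auto simp: le_fun_def)
    then show "- p (- v) \<le> q v" by linarith
  qed
  have lower: "m v \<le> q v" if "q \<in> C" for q v
    unfolding m_def using bdd that by (rule cINF_lower)
  have greatest: "b \<le> m v" if "\<And>q. q \<in> C \<Longrightarrow> b \<le> q v" for b v
    unfolding m_def using ne that by (rule cINF_greatest)
  have "m (u + v) \<le> m u + m v" for u v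
  proof -
    have "m (u + v) \<le> q u + q' v" if "q \<in> C" "q' \<in> C" for q q'
    proof -
      obtain r where "r \<in> C" "r \<le> q" "r \<le> q'"
        using chain \<open>q \<in> C\<close> \<open>q' \<in> C\<close> by blast
      then have "m (u + v) \<le> r (u + v)" "r (u + v) \<le> r u + r v" "r u \<le> q u" "r v \<le> q' v"
        using lower sub unfolding sublinear_def by (auto simp: le_fun_def)
      then show ?thesis by linarith
    qed
    then have "m (u + v) - q u \<le> m v" if "q \<in> C" for q
      using that by (intro greatest) (smt (verit))
    then have "m (u + v) - m v \<le> m u"
      by (intro greatest) (simp add: algebra_simps)
    then show ?thesis by simp
  qed
  moreover have "m (c *\<^sub>R v) \<le> c * m v" if "c > 0" for c v
  proof -
    have "m (c *\<^sub>R v) / c \<le> q v" if "q \<in> C" for q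
      using lower[OF that, of "c *\<^sub>R v"] sublinear_scaleR[of q c v] sub[OF that] \<open>c > 0\<close>
      by (simp add: field_simps)
    then have "m (c *\<^sub>R v) / c \<le> m v"
      by (rule greatest)
    then show ?thesis using \<open>c > 0\<close> by (simp add: field_simps)
  qed
  ultimately have "sublinear m"
    unfolding sublinear_def by blast
  moreover have "m \<le> p"
    using ne lower sub by (fastforce simp: le_fun_def intro: order_trans)
  ultimately show ?thesis
    using lower by (auto simp: le_fun_def)
qed

text \<open>The Hahn--Banach theorem. By Zorn's lemma there is a minimal sublinear functional \<open>m\<close> below \<open>p\<close>.
  Flattening \<open>m\<close> along any \<open>y\<close> gives a sublinear functional below \<open>m\<close>, hence \<open>m\<close> itself; so
  \<open>m (- y) \<le> - m y\<close>. Thus \<open>m\<close> is odd, and an odd sublinear functional is linear. Working with total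
  functionals avoids partial extensions on subspaces.\<close>

theorem sublinear_dominates_linear:
  fixes p :: "'v::real_vector \<Rightarrow> real"
  assumes p: "sublinear p"
  obtains f where "linear f" "f \<le> p"
proof -
  let ?A = "{q. sublinear q \<and> q \<le> p}"
  have "\<exists>m\<in>?A. \<forall>q\<in>?A. m \<ge> q \<longrightarrow> q = m"
  proof (rule predicate_Zorn)
    show "partial_order_on ?A (relation_of (\<ge>) ?A)"
      by (rule partial_order_on_relation_ofI) auto
  next
    fix C assume C: "C \<in> Chains (relation_of (\<ge>) ?A)"
    have sub: "sublinear q \<and> q \<le> p" if "q \<in> C" for q
      using C that by (auto simp: Chains_def relation_of_def)
    have chain: "q \<le> q' \<or> q' \<le> q" if "q \<in> C" "q' \<in> C" for q q'
      using C that by (auto simp: Chains_def relation_of_def)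
    show "\<exists>u\<in>?A. \<forall>a\<in>C. a \<ge> u"
    proof (cases "C = {}")
      case True
      then show ?thesis using p by auto
    next
      case False
      from sublinear_chain_lower_bound[OF sub chain False] show ?thesis by blast
    qed
  qed
  then obtain m where m: "sublinear m" "m \<le> p"
    and min: "\<And>q. sublinear q \<Longrightarrow> q \<le> m \<Longrightarrow> q = m"
    by (smt (verit) mem_Collect_eq order_trans)
  have "flatten_along m y = m" for y
    using m flatten_along_le_self sublinear_flatten_along
    by (intro min) (auto simp: le_fun_def)
  then have "m (- y) \<le> - m y" for y
    using flatten_along_minus[OF m(1), of y] by simp
  then have odd: "m (- y) = - m y" for y
    using sublinear_minus_ge[OF m(1), of y] by (smt (verit))
  have le: "m (x + y) \<le> m x + m y" for x y
    using m(1) unfolding sublinear_def by blast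
  have "m (x + y) = m x + m y" for x y
    using le[of x y] le[of "- x" "- y"] odd[of "x + y"] by (simp add: odd)
  moreover have "m (c *\<^sub>R x) = c *\<^sub>R m x" for c x
  proof (cases "c > 0")
    case True
    then show ?thesis using sublinear_scaleR[OF m(1)] by simp
  next
    case False
    then show ?thesis
      using sublinear_scaleR[OF m(1), of "- c" x] odd[of "c *\<^sub>R x"] sublinear_zero[OF m(1)]
      by (cases "c = 0") auto
  qed
  ultimately have "linear m"
    by (rule linearI)
  with m show ?thesis using that by blast
qed

text \<open>A linear functional below the norm flattened along \<open>x\<close> is at most \<open>- norm x\<close> at \<open>- x\<close>, which
  forces its value at \<open>x\<close>.\<close>

lemma norming_functional:
  fixes x :: "'a::real_normed_vector"
  obtains f :: "'a \<Rightarrow>\<^sub>L real" where "norm f \<le> 1" "f x = norm x"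
proof -
  obtain g where g: "linear g" "g \<le> flatten_along norm x"
    using sublinear_dominates_linear[OF sublinear_flatten_along[OF sublinear_norm]] by blast
  have le: "g v \<le> norm v" for v
    using g(2) flatten_along_le_self[OF sublinear_norm, of x v]
    by (auto simp: le_fun_def intro: order_trans)
  have abs: "\<bar>g v\<bar> \<le> norm v" for v
    using le[of v] le[of "- v"] linear_neg[OF g(1), of v] by simp
  have "g (- x) \<le> - norm x"
    using g(2) flatten_along_minus[OF sublinear_norm, of x]
    by (auto simp: le_fun_def intro: order_trans)
  then have gx: "g x = norm x"
    using le[of x] linear_neg[OF g(1), of x] by simp
  have "bounded_linear g"
    using g(1) abs by (intro bounded_linear.intro bounded_linear_axioms.intro) (auto intro!: exI[of _ 1])
  then have app: "blinfun_apply (Blinfun g) = g"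
    by (rule bounded_linear_Blinfun_apply)
  show ?thesis
    using abs gx by (intro that[of "Blinfun g"] norm_blinfun_bound) (auto simp: app)
qed

section \<open>Ultrafilters\<close>

text \<open>Properness together with the dichotomy for predicates says that \<open>U\<close> is an ultrafilter.\<close>

definition ultra :: "'i filter \<Rightarrow> bool" where
  "ultra U \<longleftrightarrow> U \<noteq> bot \<and> (\<forall>P. eventually P U \<or> eventually (\<lambda>i. \<not> P i) U)"

text \<open>A minimal proper filter below \<open>F\<close> exists by Zorn's lemma, since the infimum of a chain of proper
  filters is proper. It is an ultrafilter: restricting it to \<open>P\<close> either changes nothing
  or yields the improper filter, and then \<open>P\<close> eventually fails.\<close>

lemma ultra_refinement:
  assumes "F \<noteq> bot"
  obtains U where "ultra U" "U \<le> F"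
proof -
  let ?A = "{G. G \<noteq> bot \<and> G \<le> F}"
  have "\<exists>m\<in>?A. \<forall>G\<in>?A. m \<ge> G \<longrightarrow> G = m"
  proof (rule predicate_Zorn)
    show "partial_order_on ?A (relation_of (\<ge>) ?A)"
      by (rule partial_order_on_relation_ofI) auto
  next
    fix C assume C: "C \<in> Chains (relation_of (\<ge>) ?A)"
    have sub: "G \<noteq> bot \<and> G \<le> F" if "G \<in> C" for G
      using C that by (auto simp: Chains_def relation_of_def)
    have chain: "G \<le> H \<or> H \<le> G" if "G \<in> C" "H \<in> C" for G H
      using C that by (auto simp: Chains_def relation_of_def)
    show "\<exists>u\<in>?A. \<forall>a\<in>C. a \<ge> u"
    proof (cases "C = {}")
      case True
      then show ?thesis using assms by auto
    next
      case False
      have "eventually P (Inf C) \<longleftrightarrow> (\<exists>G\<in>C. eventually P G)" for P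
        using False chain by (intro eventually_Inf_base) (metis inf.orderE inf_commute order_refl)+
      then have "Inf C \<noteq> bot"
        using sub unfolding trivial_limit_def by blast
      moreover have "Inf C \<le> F"
        using False sub by (meson Inf_lower2 ex_in_conv)
      ultimately show ?thesis
        by (auto intro: Inf_lower)
    qed
  qed
  then obtain U where U: "U \<noteq> bot" "U \<le> F"
    and min: "\<And>G. G \<noteq> bot \<Longrightarrow> G \<le> U \<Longrightarrow> G = U"
    by (smt (verit) mem_Collect_eq order_trans)
  have "eventually P U \<or> eventually (\<lambda>i. \<not> P i) U" for P
  proof (cases "inf U (principal {i. P i}) = bot")
    case True
    then show ?thesis
      by (simp add: trivial_limit_def eventually_inf_principal)
  next
    case False
    then have "inf U (principal {i. P i}) = U"
      by (intro min) auto
    moreover have "eventually P (inf U (principal {i. P i}))"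
      by (simp add: eventually_inf_principal)
    ultimately show ?thesis by simp
  qed
  with U show ?thesis
    using that unfolding ultra_def by blast
qed

text \<open>A cluster point exists by compactness, and for an ultrafilter cluster points are limits.\<close>

lemma ultra_tendsto_compact:
  assumes U: "ultra U" and "compact K" and "\<And>i. a i \<in> K"
  shows "\<exists>l. (a \<longlongrightarrow> l) U"
proof -
  have "filtermap a U \<noteq> bot" "eventually (\<lambda>x. x \<in> K) (filtermap a U)"
    using U assms(3) by (auto simp: ultra_def filtermap_bot_iff eventually_filtermap)
  then obtain l where l: "inf (nhds l) (filtermap a U) \<noteq> bot"
    using \<open>compact K\<close> unfolding compact_filter by blast
  have "eventually (\<lambda>i. a i \<in> S) U" if S: "open S" "l \<in> S" for S
  proof (rule ccontr)
    assume "\<not> eventually (\<lambda>i. a i \<in> S) U"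
    then have "eventually (\<lambda>x. x \<notin> S) (filtermap a U)"
      using U by (auto simp: ultra_def eventually_filtermap)
    moreover have "eventually (\<lambda>x. x \<in> S) (nhds l)"
      using S by (rule eventually_nhds_in_open)
    ultimately have "inf (nhds l) (filtermap a U) = bot"
      unfolding trivial_limit_def eventually_inf by blast
    with l show False by contradiction
  qed
  then show ?thesis
    by (blast intro: topological_tendstoI)
qed

section \<open>Weak limits\<close>

text \<open>Weak compactness of the unit ball. Mapping \<open>f\<close> to the limit of \<open>f (s i)\<close> along the
  ultrafilter gives an element of the bidual of norm at most one, because limits respect the linear operations
  and bounds; by reflexivity it is evaluation at a vector.\<close>

lemma reflexive_ultra_weak_limit:
  fixes s :: "'i \<Rightarrow> 'a::real_normed_vector"
  assumes refl: "reflexive_space TYPE('a)" and U: "ultra U" and s: "\<And>i. norm (s i) \<le> 1"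
  obtains x where "norm x \<le> 1" "\<And>f. ((\<lambda>i. blinfun_apply f (s i)) \<longlongrightarrow> (blinfun_apply f x :: real)) U"
proof -
  have nb: "U \<noteq> bot" using U by (simp add: ultra_def)
  have bound: "norm (blinfun_apply f (s i)) \<le> norm f" for f :: "'a \<Rightarrow>\<^sub>L real" and i
    using norm_blinfun[of f "s i"] s[of i] mult_left_le[of "norm (s i)" "norm f"] by simp
  have "\<forall>f :: 'a \<Rightarrow>\<^sub>L real. \<exists>l. ((\<lambda>i. f (s i)) \<longlongrightarrow> l) U"
    using bound by (intro allI ultra_tendsto_compact[OF U compact_cball, of _ 0]) auto
  from choice[OF this]
  obtain \<phi> :: "('a \<Rightarrow>\<^sub>L real) \<Rightarrow> real"
    where \<phi>: "\<And>f. ((\<lambda>i. blinfun_apply f (s i)) \<longlongrightarrow> \<phi> f) U"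
    by blast
  have \<phi>_bound: "norm (\<phi> f) \<le> norm f" for f
    using bound by (intro Lim_norm_ubound[OF nb \<phi>]) auto
  have "bounded_linear \<phi>"
  proof (rule bounded_linear_intro)
    fix f g :: "'a \<Rightarrow>\<^sub>L real" and c :: real
    show "\<phi> (f + g) = \<phi> f + \<phi> g"
      using tendsto_unique[OF nb \<phi>[of "f + g"]] tendsto_add[OF \<phi>[of f] \<phi>[of g]]
      by (simp add: blinfun.add_left)
    show "\<phi> (c *\<^sub>R f) = c *\<^sub>R \<phi> f"
      using tendsto_unique[OF nb \<phi>[of "c *\<^sub>R f"]] tendsto_scaleR[OF tendsto_const[of c] \<phi>[of f]]
      by (simp add: blinfun.scaleR_left)
    show "norm (\<phi> f) \<le> norm f * 1"
      using \<phi>_bound by simp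
  qed
  then obtain x where x: "\<And>f. \<phi> f = blinfun_apply f x"
    using refl unfolding reflexive_space_def
    by (metis bounded_linear_Blinfun_apply)
  \<comment> \<open>Evaluation at \<open>x\<close> has norm at most one on the dual; a norming functional turns this into
    a bound on \<open>x\<close>.\<close>
  obtain f :: "'a \<Rightarrow>\<^sub>L real" where f: "norm f \<le> 1" "f x = norm x"
    by (rule norming_functional)
  then have "norm x \<le> 1"
    using \<phi>_bound[of f] by (simp add: x)
  with \<phi> show ?thesis
    using that by (simp add: x)
qed

lemma topspace_weak_topology [simp]: "topspace (weak_topology N) = UNIV"
proof -
  have "(\<lambda>_. 0) \<in> dual_wrt N"
    unfolding dual_wrt_def by (auto intro!: linearI exI[of _ 0])
  then have "UNIV \<in> {f -` U | f U. f \<in> dual_wrt N \<and> open U}"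
    by (smt (verit) mem_Collect_eq open_UNIV vimage_UNIV)
  then show ?thesis
    unfolding weak_topology_def topology_generated_by_topspace by blast
qed

text \<open>Convergence need only be tested on a subbase, by induction on how an open set is generated.\<close>

lemma limitin_weak_topology:
  assumes "\<And>f. f \<in> dual_wrt N \<Longrightarrow> ((\<lambda>i. f (s i)) \<longlongrightarrow> f l) F"
  shows "limitin (weak_topology N) s l F"
proof -
  have "l \<in> W \<longrightarrow> eventually (\<lambda>i. s i \<in> W) F"
    if "generate_topology_on {f -` U | f U. f \<in> dual_wrt N \<and> open U} W" for W
    using that
  proof (induction rule: generate_topology_on.induct)
    case (Int a b)
    then show ?case by (auto intro: eventually_conj)
  next
    case (UN K)
    then show ?case by (blast intro: eventually_mono)
  next
    case (Basis W)
    then obtain f U where "W = f -` U" "f \<in> dual_wrt N" "open U" by blast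
    then show ?case using topological_tendstoD[OF assms] by simp
  qed simp
  then have "openin (weak_topology N) W \<and> l \<in> W \<longrightarrow> eventually (\<lambda>i. s i \<in> W) F" for W
    unfolding weak_topology_def openin_topology_generated_by_iff by blast
  then show ?thesis
    by (simp add: limitin_def)
qed

lemma continuous_map_weak_functional:
  assumes "f \<in> dual_wrt N"
  shows "continuous_map (weak_topology N) euclidean f"
proof -
  have "openin (weak_topology N) (f -` U)" if "open U" for U
    unfolding weak_topology_def using assms that by (intro topology_generated_by_Basis) auto
  then show ?thesis
    by (simp add: continuous_map_def vimage_def)
qed

lemma dual_wrt_norm_blinfun: "blinfun_apply f \<in> dual_wrt norm"
proof -
  have "linear (blinfun_apply f)"
    by (rule bounded_linear.linear[OF blinfun.bounded_linear_right])
  moreover have "\<bar>blinfun_apply f v\<bar> \<le> norm f * norm v" for v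
    using norm_blinfun[of f v] by simp
  ultimately show ?thesis
    unfolding dual_wrt_def by blast
qed

text \<open>Reduces weak convergence in the product to weak convergence of both coordinates.\<close>

lemma dual_wrt_max_norm_split:
  fixes f :: "'a::real_normed_vector \<times> 'b::real_normed_vector \<Rightarrow> real"
  assumes "f \<in> dual_wrt max_norm"
  obtains g :: "'a \<Rightarrow>\<^sub>L real" and h :: "'b \<Rightarrow>\<^sub>L real" where "\<And>x y. f (x, y) = g x + h y"
proof -
  obtain K where f: "linear f" and K: "\<And>v. \<bar>f v\<bar> \<le> K * max_norm v"
    using assms unfolding dual_wrt_def by blast
  interpret f: linear f by (rule f)
  have "bounded_linear (\<lambda>x. f (x, 0))"
  proof (rule bounded_linear_intro[of _ K])
    show "f (x + y, 0) = f (x, 0) + f (y, 0)" for x y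
      using f.add[of "(x, 0)" "(y, 0)"] by simp
    show "f (c *\<^sub>R x, 0) = c *\<^sub>R f (x, 0)" for c x
      using f.scale[of c "(x, 0)"] by simp
    show "norm (f (x, 0)) \<le> norm x * K" for x
      using K[of "(x, 0)"] by (simp add: max_norm_def mult.commute)
  qed
  moreover have "bounded_linear (\<lambda>y. f (0, y))"
  proof (rule bounded_linear_intro[of _ K])
    show "f (0, x + y) = f (0, x) + f (0, y)" for x y
      using f.add[of "(0, x)" "(0, y)"] by simp
    show "f (0, c *\<^sub>R x) = c *\<^sub>R f (0, x)" for c x
      using f.scale[of c "(0, x)"] by simp
    show "norm (f (0, x)) \<le> norm x * K" for x
      using K[of "(0, x)"] by (simp add: max_norm_def mult.commute)
  qed
  moreover have "f (x, y) = f (x, 0) + f (0, y)" for x y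
    using f.add[of "(x, 0)" "(0, y)"] by simp
  ultimately show ?thesis
    by (metis that bounded_linear_Blinfun_apply)
qed

section \<open>Norm attainment\<close>

lemma dim_gt_one_sphere_nonempty:
  assumes "dim_gt_one TYPE('a::real_normed_vector)"
  shows "sphere (0::'a) 1 \<noteq> {}"
proof -
  obtain B :: "'a set" where B: "independent B" "infinite B \<or> card B > 1"
    using assms unfolding dim_gt_one_def by blast
  then obtain b where "b \<in> B" by fastforce
  then have "b \<noteq> 0" using B(1) dependent_zero by blast
  then have "b /\<^sub>R norm b \<in> sphere 0 1" by simp
  then show ?thesis by blast
qed

text \<open>Makes the supremum in \<^const>\<open>bilinear_norm\<close> a genuine one. Otherwise some sequence on the spheres has values of
  norm growing without bound, and none of its subsequences converges.\<close>

lemma compact_bilinear_bdd_above: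
  assumes "compact_bilinear T"
  shows "bdd_above ((\<lambda>(x, y). norm (T x y)) ` (sphere 0 1 \<times> sphere 0 1))"
proof (rule ccontr)
  assume "\<not> ?thesis"
  then have "\<forall>n::nat. \<exists>p \<in> sphere 0 1 \<times> sphere 0 1. norm (T (fst p) (snd p)) > real n"
    unfolding bdd_above_def by (fastforce simp: not_le)
  then obtain s where s: "\<And>n::nat. s n \<in> sphere 0 1 \<times> sphere 0 1"
    and big: "\<And>n. norm (T (fst (s n)) (snd (s n))) > real n"
    by metis
  have "max_norm (s n) \<le> 1" for n
    using s[of n] by (auto simp: max_norm_def)
  then obtain r :: "nat \<Rightarrow> nat" where r: "strict_mono r"
    and "convergent (\<lambda>n. T (fst (s (r n))) (snd (s (r n))))"
    using assms unfolding compact_bilinear_def by blast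
  then have "Bseq (\<lambda>n. T (fst (s (r n))) (snd (s (r n))))"
    using convergent_imp_Bseq by blast
  then obtain K where K: "\<And>n. norm (T (fst (s (r n))) (snd (s (r n)))) \<le> K"
    by (auto simp: Bseq_def)
  obtain n :: nat where "K < real n"
    using reals_Archimedean2 by blast
  moreover have "real n \<le> real (r n)"
    using seq_suble[OF r] by simp
  ultimately show False
    using K[of n] big[of "r n"] by linarith
qed

lemma bilinear_norm_scale:
  assumes "bilinear T"
  shows "norm (T (a *\<^sub>R x) (b *\<^sub>R y)) = \<bar>a\<bar> * \<bar>b\<bar> * norm (T x y)"
  using assms by (simp add: bilinear_lmul bilinear_rmul abs_mult)

text \<open>The image of the product of the unit balls contains its norm limit points: a weak limit \<open>(x, y)\<close> of
  the arguments along an ultrafilter is mapped to the weak limit of the values, and this equals their norm limit.\<close>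

lemma weak_weak_continuous_attains_limit:
  fixes T :: "'a::real_normed_vector \<Rightarrow> 'b::real_normed_vector \<Rightarrow> 'c::real_normed_vector"
  assumes "reflexive_space TYPE('a)" "reflexive_space TYPE('b)"
    and "weak_weak_continuous T"
    and s: "\<And>n. norm (fst (s n)) \<le> 1" "\<And>n. norm (snd (s n)) \<le> 1"
    and lim: "((\<lambda>n. T (fst (s n)) (snd (s n))) \<longlongrightarrow> z) F" and "F \<noteq> bot"
  obtains x y where "norm x \<le> 1" "norm y \<le> 1" "T x y = z"
proof -
  obtain U where U: "ultra U" "U \<le> F"
    using ultra_refinement[OF \<open>F \<noteq> bot\<close>] .
  obtain x where x: "norm x \<le> 1" "\<And>f. ((\<lambda>n. blinfun_apply f (fst (s n))) \<longlongrightarrow> (blinfun_apply f x :: real)) U"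
    by (rule reflexive_ultra_weak_limit[OF assms(1) U(1), of "\<lambda>n. fst (s n)"]) (use s(1) in auto)
  obtain y where y: "norm y \<le> 1" "\<And>f. ((\<lambda>n. blinfun_apply f (snd (s n))) \<longlongrightarrow> (blinfun_apply f y :: real)) U"
    by (rule reflexive_ultra_weak_limit[OF assms(2) U(1), of "\<lambda>n. snd (s n)"]) (use s(2) in auto)
  have weak: "limitin (weak_topology max_norm) s (x, y) U"
  proof (rule limitin_weak_topology)
    fix f :: "'a \<times> 'b \<Rightarrow> real"
    assume "f \<in> dual_wrt max_norm"
    then obtain g :: "'a \<Rightarrow>\<^sub>L real" and h :: "'b \<Rightarrow>\<^sub>L real"
      where "\<And>x y. f (x, y) = g x + h y"
      by (rule dual_wrt_max_norm_split) blast
    then have "f p = g (fst p) + h (snd p)" for p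
      by (metis prod.collapse)
    then show "((\<lambda>n. f (s n)) \<longlongrightarrow> f (x, y)) U"
      using tendsto_add[OF x(2)[of g] y(2)[of h]] by simp
  qed
  \<comment> \<open>A functional norming the difference separates \<open>T x y\<close> from \<open>z\<close> if they differ.\<close>
  obtain g :: "'c \<Rightarrow>\<^sub>L real" where g: "g (T x y - z) = norm (T x y - z)"
    by (rule norming_functional)
  have "continuous_map (weak_topology max_norm) euclidean (g \<circ> (\<lambda>(x, y). T x y))"
    using assms(3) continuous_map_weak_functional[OF dual_wrt_norm_blinfun]
    unfolding weak_weak_continuous_def by (rule continuous_map_compose)
  from continuous_map_limit[OF this weak]
  have "((\<lambda>n. g (T (fst (s n)) (snd (s n)))) \<longlongrightarrow> g (T x y)) U"
    by (simp add: o_def case_prod_beta)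
  moreover have "((\<lambda>n. g (T (fst (s n)) (snd (s n)))) \<longlongrightarrow> g z) U"
    using tendsto_mono[OF U(2) lim] by (intro tendsto_intros)
  ultimately have "g (T x y) = g z"
    using U(1) tendsto_unique unfolding ultra_def by blast
  then have "T x y = z"
    using g by (simp add: blinfun.diff_right)
  with x(1) y(1) show ?thesis by (rule that)
qed

theorem lemma3p1:
  fixes T :: "'a::banach \<Rightarrow> 'b::banach \<Rightarrow> 'c::real_normed_vector"
  assumes "reflexive_space TYPE('a)" and "reflexive_space TYPE('b)"
    and "dim_gt_one TYPE('a)" and "dim_gt_one TYPE('b)" and "dim_gt_one TYPE('c)"
    and "compact_bilinear T"
    and "weak_weak_continuous T"
  shows "\<exists>x0 \<in> sphere 0 1. \<exists>y0 \<in> sphere 0 1. norm (T x0 y0) = bilinear_norm T"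
proof -
  let ?S = "sphere (0::'a) 1 \<times> sphere (0::'b) 1"
  let ?N = "\<lambda>(x, y). norm (T x y)"
  have T: "bilinear T"
    using assms(6) by (simp add: compact_bilinear_def)
  have ne: "?S \<noteq> {}"
    using dim_gt_one_sphere_nonempty[OF assms(3)] dim_gt_one_sphere_nonempty[OF assms(4)] by blast
  have upper: "norm (T x y) \<le> bilinear_norm T" if "x \<in> sphere 0 1" "y \<in> sphere 0 1" for x y
    unfolding bilinear_norm_def
    using cSUP_upper[OF _ compact_bilinear_bdd_above[OF assms(6)], of "(x, y)"] that by simp
  have "\<exists>p\<in>?S. bilinear_norm T - 1 / Suc n < norm (T (fst p) (snd p))" for n
    using less_cSUP_iff[OF ne compact_bilinear_bdd_above[OF assms(6)], of "bilinear_norm T - 1 / Suc n"]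
    by (auto simp: bilinear_norm_def case_prod_beta)
  then obtain s where s: "\<And>n. s n \<in> ?S"
    and low: "\<And>n. bilinear_norm T - 1 / Suc n < norm (T (fst (s n)) (snd (s n)))"
    by metis
  have "(\<lambda>n. bilinear_norm T - 1 / Suc n) \<longlonglongrightarrow> bilinear_norm T"
    using tendsto_diff[OF tendsto_const LIMSEQ_inverse_real_of_nat, of "bilinear_norm T"]
    by (simp add: inverse_eq_divide)
  then have norms: "(\<lambda>n. norm (T (fst (s n)) (snd (s n)))) \<longlonglongrightarrow> bilinear_norm T"
  proof (rule tendsto_sandwich[where h = "\<lambda>_. bilinear_norm T", rotated 2])
    show "\<forall>\<^sub>F n in sequentially. bilinear_norm T - 1 / Suc n \<le> norm (T (fst (s n)) (snd (s n)))"
      using low by (intro always_eventually allI less_imp_le)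
    show "\<forall>\<^sub>F n in sequentially. norm (T (fst (s n)) (snd (s n))) \<le> bilinear_norm T"
      using s upper by (intro always_eventually) (simp add: mem_Times_iff)
    show "(\<lambda>_. bilinear_norm T) \<longlonglongrightarrow> bilinear_norm T"
      by (rule tendsto_const)
  qed
  have s1: "norm (fst (s n)) = 1" "norm (snd (s n)) = 1" for n
    using s[of n] by (auto simp: mem_Times_iff)
  then have "max_norm (s n) \<le> 1" for n
    by (simp add: max_norm_def)
  then obtain r :: "nat \<Rightarrow> nat" and z where r: "strict_mono r"
    and z: "(\<lambda>n. T (fst (s (r n))) (snd (s (r n)))) \<longlonglongrightarrow> z"
    using assms(6) unfolding compact_bilinear_def convergent_def by blast
  have norm_z: "norm z = bilinear_norm T"
    using LIMSEQ_unique[OF tendsto_norm[OF z]] LIMSEQ_subseq_LIMSEQ[OF norms r] by (simp add: o_def)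
  obtain x y where x: "norm x \<le> 1" and y: "norm y \<le> 1" and xy: "T x y = z"
    by (rule weak_weak_continuous_attains_limit[OF assms(1,2,7) _ _ z])
      (use s1 in auto)
  show ?thesis
  proof (cases "bilinear_norm T = 0")
    case True
    obtain u v where "u \<in> sphere (0::'a) 1" "v \<in> sphere (0::'b) 1"
      using ne by blast
    with True upper[of u v] show ?thesis by (metis norm_le_zero_iff norm_zero)
  next
    case False
    then have nz: "x \<noteq> 0" "y \<noteq> 0"
      using xy norm_z bilinear_lzero[OF T] bilinear_rzero[OF T] by auto
    let ?x = "x /\<^sub>R norm x" and ?y = "y /\<^sub>R norm y"
    have mem: "?x \<in> sphere 0 1" "?y \<in> sphere 0 1"
      using nz by auto
    \<comment> \<open>As \<open>x\<close> and \<open>y\<close> lie in the unit balls, passing to the spheres does not decrease the value.\<close>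
    have "norm (T x y) = norm x * norm y * norm (T ?x ?y)"
      using bilinear_norm_scale[OF T, of "norm x" ?x "norm y" ?y] nz by simp
    also have "\<dots> \<le> 1 * norm (T ?x ?y)"
      using x y by (intro mult_right_mono mult_le_one) auto
    finally have "bilinear_norm T \<le> norm (T ?x ?y)"
      using xy norm_z by simp
    with upper[OF mem] mem show ?thesis by (metis order_antisym)
  qed
qed

end
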